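(* Let $A$ be a $k\times k$ complex matrix, and let $\chi_A(x)=(x-\alpha_1)^{m_1}(x-\alpha_2)^{m_2}\cdots(x-\alpha_s)^{m_s}$ be its characteristic polynomial, where $\alpha_1,\ldots,\alpha_s$ are distinct complex numbers. For $1\le j\le s$ and $0\le r\le m_j-1$ put $B_{jr}=L_{jr}(A)[\chi_A]$. Then, for all $t\in\mathbb{C}$, $$e^{tA}=\sum_{j=1}^{s}\sum_{r=0}^{m_j-1}\frac{t^{r}}{r!}e^{\alpha_j t}B_{jr}.$$ Moreover, for $i\neq j$, and all $0\le q\le m_i-1$, $0\le r\le m_j-1$, $$B_{iq}B_{jr}=B_{jr}B_{iq}=0.$$
   Context: For a non-constant polynomial $P(x)=(x-\alpha_1)^{m_1}\cdots(x-\alpha_s)^{m_s}$ with $\alpha_1,\ldots,\alpha_s\in\mathbb{C}$ distinct and $m_1,\ldots,m_s$ nonnegative integers, set, for $1\le j\le s$, $P_j(x)=\prod_{i\ne j}(x-\alpha_i)^{m_i}=P(x)/(x-\alpha_j)^{m_j}$ and $g_j(x)=1/P_j(x)$. For $1\le j\le s$ and $0\le r\le m_j-1$ define the polynomial $$L_{jr}(x)[P]=P_j(x)(x-\alpha_j)^{r}\sum_{i=0}^{m_j-1-r}\frac{1}{i!}g_j^{(i)}(\alpha_j)(x-\alpha_j)^i.$$ $L_{jr}(A)[P]$ denotes the matrix obtained by evaluating this polynomial at the matrix $A$. The matrix exponential is $e^{tA}=\sum_{n\ge 0}\frac{t^n}{n!}A^n$. *)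

theory Defs
  imports
    "HOL-Analysis.Analysis"
    "Jordan_Normal_Form.Char_Poly"
begin

text \<open>
  A polynomial \<open>P(x) = (x - \<alpha>\<^sub>1)^m\<^sub>1 \<cdots> (x - \<alpha>\<^sub>s)^m\<^sub>s\<close> is given by its factorisation data:
  the number \<open>s\<close>, the roots \<open>\<alpha> i\<close> and the exponents \<open>m i\<close>, where only the indices
  \<open>i \<in> {1..s}\<close> matter.
\<close>

definition root_poly :: "nat \<Rightarrow> (nat \<Rightarrow> complex) \<Rightarrow> (nat \<Rightarrow> nat) \<Rightarrow> complex poly" where
  "root_poly s \<alpha> m = (\<Prod>i\<in>{1..s}. [:- \<alpha> i, 1:] ^ m i)"

definition cofactor_poly ::
    "nat \<Rightarrow> (nat \<Rightarrow> complex) \<Rightarrow> (nat \<Rightarrow> nat) \<Rightarrow> nat \<Rightarrow> complex poly" where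
  "cofactor_poly s \<alpha> m j = (\<Prod>i\<in>{1..s} - {j}. [:- \<alpha> i, 1:] ^ m i)"

definition recip_cofactor ::
    "nat \<Rightarrow> (nat \<Rightarrow> complex) \<Rightarrow> (nat \<Rightarrow> nat) \<Rightarrow> nat \<Rightarrow> complex \<Rightarrow> complex" where
  "recip_cofactor s \<alpha> m j x = 1 / poly (cofactor_poly s \<alpha> m j) x"

text \<open>The polynomial \<open>L\<^sub>j\<^sub>r(x)[P]\<close>; it is meant for \<open>r < m j\<close> only, so that the
  subtraction below does not truncate.\<close>

definition L_poly ::
    "nat \<Rightarrow> (nat \<Rightarrow> complex) \<Rightarrow> (nat \<Rightarrow> nat) \<Rightarrow> nat \<Rightarrow> nat \<Rightarrow> complex poly" where
  "L_poly s \<alpha> m j r =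
     cofactor_poly s \<alpha> m j * [:- \<alpha> j, 1:] ^ r *
     (\<Sum>i = 0..m j - 1 - r.
        Polynomial.smult (1 / fact i * (deriv ^^ i) (recip_cofactor s \<alpha> m j) (\<alpha> j))
          ([:- \<alpha> j, 1:] ^ i))"

text \<open>Matrices of different sizes share one type, so finite sums of \<open>k \<times> k\<close> matrices are
  taken in the module of \<open>k \<times> k\<close> matrices.\<close>

definition poly_at_mat :: "complex poly \<Rightarrow> complex mat \<Rightarrow> complex mat" where
  "poly_at_mat p A =
     (\<Oplus>\<^bsub>module_mat TYPE(complex) (dim_row A) (dim_row A)\<^esub> n\<in>{0..Polynomial.degree p}.
        Polynomial.coeff p n \<cdot>\<^sub>m (A ^\<^sub>m n))"

text \<open>The matrix \<open>e^(tA) = \<Sum>n. t^n / n! A^n\<close> of a square matrix \<open>A\<close>, the series being summed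
  entrywise. The entry series always converge, see \<open>exp_mat_sums\<close>.\<close>

definition exp_mat :: "complex \<Rightarrow> complex mat \<Rightarrow> complex mat" where
  "exp_mat t A =
     mat (dim_row A) (dim_row A) (\<lambda>(a, b). \<Sum>n. (t ^ n / fact n \<cdot>\<^sub>m (A ^\<^sub>m n)) $$ (a, b))"

lemma norm_pow_mat_entry_le:
  fixes A :: "complex mat"
  assumes A: "A \<in> carrier_mat k k"
    and M: "\<And>a b. a < k \<Longrightarrow> b < k \<Longrightarrow> norm (A $$ (a, b)) \<le> M"
  shows "a < k \<Longrightarrow> b < k \<Longrightarrow> norm ((A ^\<^sub>m n) $$ (a, b)) \<le> (real k * M) ^ n"
proof (induction n arbitrary: a b)
  case 0
  then show ?case using A by auto
next
  case (Suc n)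
  have M0: "M \<ge> 0" using M[OF Suc.prems] norm_ge_zero order_trans by blast
  have P: "A ^\<^sub>m n \<in> carrier_mat k k" using A by (rule pow_carrier_mat)
  have "(A ^\<^sub>m Suc n) $$ (a, b) = (\<Sum>c\<in>{0..<k}. (A ^\<^sub>m n) $$ (a, c) * A $$ (c, b))"
    using A P Suc.prems by (simp add: scalar_prod_def)
  also have "norm \<dots> \<le> (\<Sum>c\<in>{0..<k}. (real k * M) ^ n * M)"
    using Suc M M0 by (intro sum_norm_le) (auto simp: norm_mult intro!: mult_mono)
  finally show ?case by (simp add: mult_ac)
qed

lemma exp_mat_sums:
  fixes A :: "complex mat"
  assumes A: "A \<in> carrier_mat k k" and ab: "a < k" "b < k"
  shows "(\<lambda>n. (t ^ n / fact n \<cdot>\<^sub>m (A ^\<^sub>m n)) $$ (a, b)) sums (exp_mat t A $$ (a, b))"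
proof -
  define M where "M = Max ((\<lambda>(a, b). norm (A $$ (a, b))) ` ({..<k} \<times> {..<k}))"
  have M: "norm (A $$ (a, b)) \<le> M" if "a < k" "b < k" for a b
    unfolding M_def using that by (intro Max_ge) auto
  have P: "A ^\<^sub>m n \<in> carrier_mat k k" for n using A by (rule pow_carrier_mat)
  have "norm ((t ^ n / fact n \<cdot>\<^sub>m (A ^\<^sub>m n)) $$ (a, b))
      \<le> (norm t * (real k * M)) ^ n /\<^sub>R fact n" for n
  proof -
    have "(t ^ n / fact n \<cdot>\<^sub>m (A ^\<^sub>m n)) $$ (a, b) = t ^ n / fact n * (A ^\<^sub>m n) $$ (a, b)"
      using carrier_matD[OF P[of n]] ab by simp
    also have "norm \<dots> = norm t ^ n / fact n * norm ((A ^\<^sub>m n) $$ (a, b))"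
      by (simp add: norm_mult norm_divide norm_power)
    also have "\<dots> \<le> norm t ^ n / fact n * (real k * M) ^ n"
      using norm_pow_mat_entry_le[OF A M ab, of n] by (intro mult_left_mono) auto
    also have "\<dots> = (norm t * (real k * M)) ^ n /\<^sub>R fact n"
      by (simp only: power_mult_distrib divide_inverse real_scaleR_def mult_ac)
    finally show ?thesis .
  qed
  then have "summable (\<lambda>n. (t ^ n / fact n \<cdot>\<^sub>m (A ^\<^sub>m n)) $$ (a, b))"
    by (intro summable_comparison_test'[OF summable_exp_generic[of "norm t * (real k * M)"]])
  then show ?thesis using A ab by (simp add: exp_mat_def summable_sums)
qed

end

theory Submission
  imports Defs "HOL-Computational_Algebra.Field_as_Ring"
begin

text \<open>
  Both claims are statements about polynomials modulo \<open>\<chi>\<close>, the characteristic polynomial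
  of \<open>A\<close>: evaluation at \<open>A\<close> is a ring homomorphism (\<open>poly_at_mat_mult\<close>) which kills
  every multiple of \<open>\<chi>\<close> by the Cayley--Hamilton theorem (\<open>cayley_hamilton\<close>).

  The polynomials \<open>L\<^sub>j\<^sub>r\<close> are the Hermite interpolation basis for the roots \<open>\<alpha>\<^sub>j\<close> with
  multiplicities \<open>m\<^sub>j\<close>. Modulo \<open>(x - \<alpha>\<^sub>i)^m\<^sub>i\<close> with \<open>i \<noteq> j\<close> the cofactor in \<open>L\<^sub>j\<^sub>r\<close>
  vanishes (\<open>L_poly_dvd_other\<close>); modulo \<open>(x - \<alpha>\<^sub>j)^m\<^sub>j\<close> the Taylor polynomial of the
  reciprocal cofactor cancels the cofactor, so that \<open>L\<^sub>j\<^sub>r\<close> is congruent to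
  \<open>(x - \<alpha>\<^sub>j)^r\<close> (\<open>L_poly_local\<close>).

  The powers \<open>(x - \<alpha>\<^sub>i)^m\<^sub>i\<close> are pairwise coprime, so congruences modulo each of them give
  a congruence modulo \<open>\<chi>\<close>. Applied to a product \<open>L\<^sub>i\<^sub>q L\<^sub>j\<^sub>r\<close> with \<open>i \<noteq> j\<close>, where every
  power divides one of the two factors, this yields the orthogonality of the \<open>B\<^sub>j\<^sub>r\<close>. Applied
  to \<open>x^n\<close>, whose expansion around \<open>\<alpha>\<^sub>j\<close> is the binomial formula, it yields
  \<open>A^n = \<Sum>j r. (n choose r) \<alpha>\<^sub>j^(n - r) B\<^sub>j\<^sub>r\<close> for every \<open>n\<close> (\<open>hermite_monom\<close>).
  Multiplying by \<open>t^n / n!\<close> and summing over \<open>n\<close> turns the scalar coefficient of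
  \<open>B\<^sub>j\<^sub>r\<close> into \<open>t^r / r! e^(\<alpha>\<^sub>j t)\<close> (\<open>binomial_exp_sums\<close>).
\<close>

section \<open>Polynomials evaluated at a matrix\<close>

lemma finsum_mat:
  fixes f :: "'i \<Rightarrow> 'a :: comm_ring_1 mat"
  assumes "finite I" and "\<And>i. i \<in> I \<Longrightarrow> f i \<in> carrier_mat nr nc"
  shows finsum_mat_closed: "finsum (module_mat TYPE('a) nr nc) f I \<in> carrier_mat nr nc" (is ?C)
    and index_finsum_mat: "\<And>a b. a < nr \<Longrightarrow> b < nc \<Longrightarrow>
      finsum (module_mat TYPE('a) nr nc) f I $$ (a, b) = (\<Sum>i\<in>I. f i $$ (a, b))"
proof -
  interpret M: abelian_group "module_mat TYPE('a) nr nc" by (rule abelian_group_mat)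
  have closed: "finsum (module_mat TYPE('a) nr nc) f J \<in> carrier_mat nr nc" if "J \<subseteq> I" for J
    using M.finsum_closed[of f J] assms(2) that by (auto simp: module_mat_simps Pi_def)
  show ?C by (rule closed) simp
  fix a b assume ab: "a < nr" "b < nc"
  show "finsum (module_mat TYPE('a) nr nc) f I $$ (a, b) = (\<Sum>i\<in>I. f i $$ (a, b))"
    using assms(1) order_refl[of I]
  proof (induction rule: finite_subset_induct')
    case empty
    show ?case using ab by (simp add: module_mat_simps)
  next
    case (insert i J)
    have "finsum (module_mat TYPE('a) nr nc) f (insert i J)
        = f i + finsum (module_mat TYPE('a) nr nc) f J"
      using insert assms(2) by (subst M.finsum_insert) (auto simp: module_mat_simps Pi_def)
    moreover have "finsum (module_mat TYPE('a) nr nc) f J \<in> carrier_mat nr nc"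
      using insert by (intro closed) auto
    ultimately show ?case using insert ab by simp
  qed
qed

lemma poly_at_mat_closed [simp]:
  assumes "A \<in> carrier_mat k k"
  shows "poly_at_mat p A \<in> carrier_mat k k"
  using assms unfolding poly_at_mat_def
  by (auto intro!: finsum_mat_closed pow_carrier_mat)

text \<open>The upper bound \<open>N\<close> is arbitrary beyond the degree so that polynomials of different
  degrees can be compared over a common range of summation.\<close>

lemma index_poly_at_mat:
  assumes A: "A \<in> carrier_mat k k" and "a < k" "b < k" and N: "Polynomial.degree p \<le> N"
  shows "poly_at_mat p A $$ (a, b) = (\<Sum>n\<le>N. Polynomial.coeff p n * (A ^\<^sub>m n) $$ (a, b))"
proof -
  have P: "A ^\<^sub>m n \<in> carrier_mat k k" for n using A by (rule pow_carrier_mat)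
  have "poly_at_mat p A $$ (a, b)
      = (\<Sum>n\<in>{0..Polynomial.degree p}. (Polynomial.coeff p n \<cdot>\<^sub>m (A ^\<^sub>m n)) $$ (a, b))"
    using assms carrier_matD[OF A] P unfolding poly_at_mat_def
    by (simp only:) (rule index_finsum_mat, auto)
  also have "\<dots> = (\<Sum>n\<in>{0..Polynomial.degree p}. Polynomial.coeff p n * (A ^\<^sub>m n) $$ (a, b))"
    using assms carrier_matD[OF P] by (intro sum.cong) auto
  also have "\<dots> = (\<Sum>n\<le>N. Polynomial.coeff p n * (A ^\<^sub>m n) $$ (a, b))"
    using N by (intro sum.mono_neutral_left) (auto simp: coeff_eq_0)
  finally show ?thesis .
qed

lemma poly_at_mat_0:
  assumes A: "A \<in> carrier_mat k k"
  shows "poly_at_mat 0 A = 0\<^sub>m k k"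
  by (rule eq_matI) (use A in \<open>auto simp: index_poly_at_mat[OF A, where N = 0]
        carrier_matD[OF poly_at_mat_closed[OF A]]\<close>)

text \<open>Horner's rule. The factor \<open>A\<close> stands on the right because powers of a matrix unfold
  on that side.\<close>

lemma poly_at_mat_pCons:
  assumes A: "A \<in> carrier_mat k k"
  shows "poly_at_mat (pCons c p) A = c \<cdot>\<^sub>m 1\<^sub>m k + poly_at_mat p A * A"
proof (rule eq_matI)
  note P = pow_carrier_mat[OF A] and pc = poly_at_mat_closed[OF A]
  fix a b assume "a < dim_row (c \<cdot>\<^sub>m 1\<^sub>m k + poly_at_mat p A * A)"
    "b < dim_col (c \<cdot>\<^sub>m 1\<^sub>m k + poly_at_mat p A * A)"
  then have ab: "a < k" "b < k" using A carrier_matD[OF pc[of p]] by auto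
  define N where "N = Polynomial.degree p"
  have "poly_at_mat (pCons c p) A $$ (a, b)
      = (\<Sum>n\<le>Suc N. Polynomial.coeff (pCons c p) n * (A ^\<^sub>m n) $$ (a, b))"
    using A ab by (intro index_poly_at_mat) (auto simp: N_def degree_pCons_le)
  also have "\<dots> = c * (1\<^sub>m k) $$ (a, b)
      + (\<Sum>n\<le>N. Polynomial.coeff p n * (A ^\<^sub>m Suc n) $$ (a, b))"
    using A by (subst sum.atMost_Suc_shift) simp
  also have "(\<Sum>n\<le>N. Polynomial.coeff p n * (A ^\<^sub>m Suc n) $$ (a, b))
      = (\<Sum>n\<le>N. \<Sum>d<k. Polynomial.coeff p n * (A ^\<^sub>m n) $$ (a, d) * A $$ (d, b))"
  proof (rule sum.cong[OF refl])
    fix n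
    show "Polynomial.coeff p n * (A ^\<^sub>m Suc n) $$ (a, b)
      = (\<Sum>d<k. Polynomial.coeff p n * (A ^\<^sub>m n) $$ (a, d) * A $$ (d, b))"
      using A P[of n] ab
      by (simp add: scalar_prod_def sum_distrib_left atLeast0LessThan mult.assoc)
  qed
  also have "\<dots> = (\<Sum>d<k. poly_at_mat p A $$ (a, d) * A $$ (d, b))"
    using A ab by (subst sum.swap)
      (simp add: index_poly_at_mat[OF A, where N = N] N_def sum_distrib_right)
  also have "\<dots> = (poly_at_mat p A * A) $$ (a, b)"
    using A carrier_matD[OF pc[of p]] ab by (simp add: scalar_prod_def atLeast0LessThan)
  finally show "poly_at_mat (pCons c p) A $$ (a, b)
      = (c \<cdot>\<^sub>m 1\<^sub>m k + poly_at_mat p A * A) $$ (a, b)"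
    using A ab carrier_matD[OF pc[of p]] by simp
qed (use A carrier_matD[OF poly_at_mat_closed[OF A]] in auto)

lemma poly_at_mat_add:
  assumes A: "A \<in> carrier_mat k k"
  shows "poly_at_mat (p + q) A = poly_at_mat p A + poly_at_mat q A"
proof (rule eq_matI)
  note pc = poly_at_mat_closed[OF A]
  fix a b assume "a < dim_row (poly_at_mat p A + poly_at_mat q A)"
    "b < dim_col (poly_at_mat p A + poly_at_mat q A)"
  then have ab: "a < k" "b < k" using carrier_matD[OF pc[of q]] by auto
  define N where "N = max (Polynomial.degree p) (Polynomial.degree q)"
  have "Polynomial.degree (p + q) \<le> N" by (simp add: N_def degree_add_le)
  then show "poly_at_mat (p + q) A $$ (a, b) = (poly_at_mat p A + poly_at_mat q A) $$ (a, b)"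
    using ab carrier_matD[OF pc[of q]]
    by (simp add: index_poly_at_mat[OF A, where N = N] N_def sum.distrib algebra_simps)
qed (use carrier_matD[OF poly_at_mat_closed[OF A]] in auto)

lemma poly_at_mat_smult:
  assumes A: "A \<in> carrier_mat k k"
  shows "poly_at_mat (Polynomial.smult c p) A = c \<cdot>\<^sub>m poly_at_mat p A"
proof (rule eq_matI)
  note pc = poly_at_mat_closed[OF A]
  fix a b assume "a < dim_row (c \<cdot>\<^sub>m poly_at_mat p A)" "b < dim_col (c \<cdot>\<^sub>m poly_at_mat p A)"
  then have ab: "a < k" "b < k" using carrier_matD[OF pc[of p]] by auto
  then show "poly_at_mat (Polynomial.smult c p) A $$ (a, b) = (c \<cdot>\<^sub>m poly_at_mat p A) $$ (a, b)"
    using carrier_matD[OF pc[of p]]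
    by (simp add: index_poly_at_mat[OF A, where N = "Polynomial.degree p"] degree_smult_le
        sum_distrib_left mult.assoc)
qed (use carrier_matD[OF poly_at_mat_closed[OF A]] in auto)

text \<open>Induction on the second factor keeps every \<open>A\<close> split off by Horner's rule at the right
  end of the product, so associativity suffices and it need not be shown first that \<open>A\<close>
  commutes with polynomials in \<open>A\<close>.\<close>

lemma poly_at_mat_mult:
  assumes A: "A \<in> carrier_mat k k"
  shows "poly_at_mat (p * q) A = poly_at_mat p A * poly_at_mat q A"
proof (induction q)
  case 0
  show ?case using A by (simp add: poly_at_mat_0[OF A] right_mult_zero_mat[OF poly_at_mat_closed[OF A]])
next
  case (pCons c q)
  note pc = poly_at_mat_closed[OF A]
  have "(0 :: complex) \<cdot>\<^sub>m 1\<^sub>m k + poly_at_mat (p * q) A * A = poly_at_mat (p * q) A * A"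
    by (rule eq_matI) (use A carrier_matD[OF pc[of "p * q"]] in auto)
  then have "poly_at_mat (p * pCons c q) A = c \<cdot>\<^sub>m poly_at_mat p A + poly_at_mat (p * q) A * A"
    by (simp add: poly_at_mat_add[OF A] poly_at_mat_smult[OF A] poly_at_mat_pCons[OF A])
  also have "\<dots> = poly_at_mat p A * (c \<cdot>\<^sub>m 1\<^sub>m k) + poly_at_mat p A * (poly_at_mat q A * A)"
    unfolding pCons.IH
    using A pc[of p] pc[of q]
    by (simp add: mult_smult_distrib[OF pc[of p] one_carrier_mat] right_mult_one_mat[OF pc]
         assoc_mult_mat[OF pc[of p] pc[of q] A])
  also have "\<dots> = poly_at_mat p A * poly_at_mat (pCons c q) A"
    unfolding poly_at_mat_pCons[OF A]
    by (rule mult_add_distrib_mat[symmetric, OF pc]) (auto intro: mult_carrier_mat[OF pc A])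
  finally show ?case .
qed

lemma index_poly_at_mat_sum:
  assumes A: "A \<in> carrier_mat k k" and ab: "a < k" "b < k"
  shows "poly_at_mat (\<Sum>i\<in>I. p i) A $$ (a, b) = (\<Sum>i\<in>I. poly_at_mat (p i) A $$ (a, b))"
  using ab carrier_matD[OF poly_at_mat_closed[OF A]]
  by (induction I rule: infinite_finite_induct)
     (simp_all add: poly_at_mat_0[OF A] poly_at_mat_add[OF A])

lemma poly_at_mat_monom:
  assumes A: "A \<in> carrier_mat k k"
  shows "poly_at_mat (Polynomial.monom 1 n) A = A ^\<^sub>m n"
proof (rule eq_matI)
  fix a b assume "a < dim_row (A ^\<^sub>m n)" "b < dim_col (A ^\<^sub>m n)"
  then have ab: "a < k" "b < k" using carrier_matD[OF pow_carrier_mat[OF A]] by auto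
  have "poly_at_mat (Polynomial.monom 1 n) A $$ (a, b)
     = (\<Sum>i\<le>n. if i = n then (A ^\<^sub>m n) $$ (a, b) else 0)"
    unfolding index_poly_at_mat[OF A ab degree_monom_le] by (intro sum.cong) auto
  then show "poly_at_mat (Polynomial.monom 1 n) A $$ (a, b) = (A ^\<^sub>m n) $$ (a, b)" by simp
qed (use carrier_matD[OF poly_at_mat_closed[OF A]] carrier_matD[OF pow_carrier_mat[OF A]] in auto)

section \<open>The Cayley--Hamilton theorem\<close>

text \<open>
  Let \<open>C = \<Sum>n. x^n D\<^sub>n\<close> be the adjugate of \<open>x - A\<close>. Comparing coefficients of \<open>x^n\<close>
  in \<open>(x - A) C = \<chi>\<close> gives \<open>\<chi>\<^sub>n = D\<^sub>n\<^sub>-\<^sub>1 - A D\<^sub>n\<close>. Multiplied by \<open>A^n\<close> from the left, the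
  right-hand sides telescope, and both ends of the telescope vanish.
\<close>

theorem cayley_hamilton:
  assumes A: "A \<in> carrier_mat k k"
  shows "poly_at_mat (char_poly A) A = 0\<^sub>m k k"
proof -
  define C where "C = adj_mat (char_poly_matrix A)"
  define D where "D n = mat k k (\<lambda>ij. Polynomial.coeff (C $$ ij) n)" for n
  \<comment> \<open>\<open>E n\<close> is \<open>D (n - 1)\<close>, with the zero matrix standing for \<open>D (-1)\<close>.\<close>
  define E where "E n = (case n of 0 \<Rightarrow> 0\<^sub>m k k | Suc n' \<Rightarrow> D n')" for n
  note P = pow_carrier_mat[OF A]
  have X: "char_poly_matrix A \<in> carrier_mat k k" using A by simp
  have C: "C \<in> carrier_mat k k" and XC: "char_poly_matrix A * C = char_poly A \<cdot>\<^sub>m 1\<^sub>m k"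
    unfolding C_def char_poly_def using adj_mat[OF X] by auto
  have D: "D n \<in> carrier_mat k k" and E: "E n \<in> carrier_mat k k" for n
    by (auto simp: D_def E_def split: nat.split)
  have coeff: "Polynomial.coeff (char_poly A) n \<cdot>\<^sub>m 1\<^sub>m k = E n - A * D n" for n
  proof (rule eq_matI)
    fix i j assume "i < dim_row (E n - A * D n)" "j < dim_col (E n - A * D n)"
    then have ij: "i < k" "j < k" using A carrier_matD[OF D[of n]] by auto
    have "(char_poly A \<cdot>\<^sub>m 1\<^sub>m k) $$ (i, j)
        = (\<Sum>l<k. char_poly_matrix A $$ (i, l) * C $$ (l, j))"
      unfolding XC[symmetric] using X C ij by (simp add: scalar_prod_def atLeast0LessThan)
    also have "\<dots> = (\<Sum>l<k. (if l = i then [:0, 1:] * C $$ (i, j) else 0)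
        - Polynomial.smult (A $$ (i, l)) (C $$ (l, j)))"
      using A ij by (intro sum.cong) (auto simp: char_poly_matrix_def algebra_simps)
    also have "\<dots> = pCons 0 (C $$ (i, j)) - (\<Sum>l<k. Polynomial.smult (A $$ (i, l)) (C $$ (l, j)))"
      using ij by (simp add: sum_subtractf)
    finally have "Polynomial.coeff ((char_poly A \<cdot>\<^sub>m 1\<^sub>m k) $$ (i, j)) n
        = E n $$ (i, j) - (\<Sum>l<k. A $$ (i, l) * D n $$ (l, j))"
      using ij by (simp add: coeff_sum E_def D_def coeff_pCons split: nat.split)
    then show "(Polynomial.coeff (char_poly A) n \<cdot>\<^sub>m 1\<^sub>m k) $$ (i, j) = (E n - A * D n) $$ (i, j)"
      using A D[of n] E[of n] ij
      by (simp add: scalar_prod_def atLeast0LessThan split: if_splits)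
  qed (use A carrier_matD[OF D[of n]] in auto)
  have telescope: "Polynomial.coeff (char_poly A) n \<cdot>\<^sub>m (A ^\<^sub>m n)
      = A ^\<^sub>m n * E n - A ^\<^sub>m Suc n * E (Suc n)" for n
  proof -
    have "Polynomial.coeff (char_poly A) n \<cdot>\<^sub>m (A ^\<^sub>m n)
        = A ^\<^sub>m n * (Polynomial.coeff (char_poly A) n \<cdot>\<^sub>m 1\<^sub>m k)"
      by (simp add: mult_smult_distrib[OF P one_carrier_mat] right_mult_one_mat[OF P])
    also have "\<dots> = A ^\<^sub>m n * E n - A ^\<^sub>m n * (A * D n)"
      unfolding coeff by (rule mult_minus_distrib_mat[OF P E]) (use A D in auto)
    also have "A ^\<^sub>m n * (A * D n) = A ^\<^sub>m Suc n * E (Suc n)"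
      using assoc_mult_mat[OF P A D] by (simp add: E_def)
    finally show ?thesis .
  qed
  \<comment> \<open>A sum instead of a maximum of degrees, as a crude common bound.\<close>
  define N where "N = Polynomial.degree (char_poly A)
    + (\<Sum>i<k. \<Sum>j<k. Suc (Polynomial.degree (C $$ (i, j))))"
  have DN: "D N = 0\<^sub>m k k"
  proof (rule eq_matI)
    fix i j assume "i < dim_row (0\<^sub>m k k :: complex mat)" "j < dim_col (0\<^sub>m k k :: complex mat)"
    then have ij: "i < k" "j < k" by auto
    have "Suc (Polynomial.degree (C $$ (i, j))) \<le> (\<Sum>j<k. Suc (Polynomial.degree (C $$ (i, j))))"
      using ij by (intro member_le_sum) auto
    also have "\<dots> \<le> (\<Sum>i<k. \<Sum>j<k. Suc (Polynomial.degree (C $$ (i, j))))"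
      using ij by (intro member_le_sum) auto
    finally have "Polynomial.degree (C $$ (i, j)) < N" by (simp add: N_def)
    then show "D N $$ (i, j) = 0\<^sub>m k k $$ (i, j)" using ij by (simp add: D_def coeff_eq_0)
  qed (auto simp: D_def)
  show ?thesis
  proof (rule eq_matI)
    fix a b assume "a < dim_row (0\<^sub>m k k :: complex mat)" "b < dim_col (0\<^sub>m k k :: complex mat)"
    then have ab: "a < k" "b < k" by auto
    have "poly_at_mat (char_poly A) A $$ (a, b)
        = (\<Sum>n\<le>N. (Polynomial.coeff (char_poly A) n \<cdot>\<^sub>m (A ^\<^sub>m n)) $$ (a, b))"
      using ab carrier_matD[OF P] index_poly_at_mat[OF A ab, of "char_poly A" N]
      by (simp add: N_def)
    also have "\<dots> = (\<Sum>n\<le>N. (A ^\<^sub>m n * E n) $$ (a, b) - (A ^\<^sub>m Suc n * E (Suc n)) $$ (a, b))"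
      unfolding telescope using ab carrier_matD[OF P] carrier_matD[OF E] A
      by (intro sum.cong refl) (subst index_minus_mat, auto)
    also have "\<dots> = (A ^\<^sub>m 0 * E 0) $$ (a, b) - (A ^\<^sub>m Suc N * E (Suc N)) $$ (a, b)"
      by (rule sum_telescope)
    also have "\<dots> = 0"
      using ab right_mult_zero_mat[OF P] DN by (simp add: E_def del: pow_mat.simps)
    finally show "poly_at_mat (char_poly A) A $$ (a, b) = 0\<^sub>m k k $$ (a, b)" using ab by simp
  qed (use carrier_matD[OF poly_at_mat_closed[OF A]] in auto)
qed

lemma poly_at_mat_eq_0:
  assumes A: "A \<in> carrier_mat k k" and "char_poly A dvd p"
  shows "poly_at_mat p A = 0\<^sub>m k k"
  using assms(2) left_mult_zero_mat[OF poly_at_mat_closed[OF A]]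
  by (auto simp: dvd_def poly_at_mat_mult[OF A] cayley_hamilton[OF A])

section \<open>Hermite interpolation at the roots\<close>

text \<open>
  After moving \<open>a\<close> to the origin, the Taylor coefficients of \<open>1 / p\<close> are those of the inverse
  of \<open>p\<close> as a formal power series, and cutting off a factor at order \<open>N\<close> does not change
  the first \<open>N\<close> coefficients of a product.
\<close>

lemma taylor_inverse_dvd:
  fixes p :: "complex poly"
  assumes "poly p a \<noteq> 0"
  shows "[:- a, 1:] ^ N dvd p * (\<Sum>i<N. Polynomial.smult
      ((deriv ^^ i) (\<lambda>x. 1 / poly p x) a / fact i) ([:- a, 1:] ^ i)) - 1" (is "_ dvd p * ?T - 1")
proof -
  define q where "q = pcompose p [:a, 1:]"
  define F where "F = inverse (fps_of_poly q)"
  have q0: "poly.coeff q 0 \<noteq> 0"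
    using assms by (simp add: q_def poly_pcompose flip: poly_0_coeff_0)
  have "poly q has_fps_expansion fps_of_poly q"
    by (simp add: has_fps_expansion_def)
  then have "(\<lambda>x. inverse (poly q x)) has_fps_expansion F"
    unfolding F_def using q0 by (intro has_fps_expansion_inverse) auto
  moreover have "(\<lambda>x. inverse (poly q x)) = (\<lambda>x. 1 / poly p x) \<circ> (\<lambda>x. a + x)"
    by (simp add: q_def poly_pcompose fun_eq_iff divide_inverse add.commute)
  ultimately have Fn: "fps_nth F n = (deriv ^^ n) (\<lambda>x. 1 / poly p x) a / fact n" for n
    using fps_nth_fps_expansion[of _ F n] higher_deriv_shift_0[of n _ a] by metis
  define T where "T = (\<Sum>i<N. Polynomial.smult (fps_nth F i) ([:0, 1:] ^ i))"
  have T: "fps_of_poly T = fps_cutoff N F"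
    by (rule fps_ext) (simp add: T_def coeff_sum flip: monom_altdef)
  have "poly.coeff (q * T - 1) n = 0" if "n < N" for n
  proof -
    have "poly.coeff (q * T) n = fps_nth (fps_of_poly q * fps_cutoff N F) n"
      by (simp flip: T fps_of_poly_mult)
    also have "\<dots> = fps_nth (fps_of_poly q * F) n" using that by (rule fps_cutoff_right_mult_nth)
    also have "fps_of_poly q * F = 1"
      unfolding F_def using q0 by (subst mult.commute) (auto intro!: inverse_mult_eq_1)
    finally show ?thesis by simp
  qed
  then have "[:0, 1:] ^ N dvd q * T - 1"
    by (simp add: monom_1_dvd_iff' flip: monom_altdef[of 1, simplified])
  then obtain u where u: "q * T - 1 = [:0, 1:] ^ N * u" by (auto simp: dvd_def)
  have shift: "pcompose [:0, 1:] [:- a, 1:] = [:- a, 1:]" by (simp add: pcompose_pCons)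
  have pow: "pcompose (r ^ n) s = pcompose r s ^ n" for r s :: "complex poly" and n
    by (induction n) (simp_all add: pcompose_mult pcompose_1)
  have "pcompose q [:- a, 1:] = p"
    unfolding q_def pcompose_assoc[symmetric] by (simp add: pcompose_pCons)
  moreover have "pcompose T [:- a, 1:] = ?T"
    by (simp add: T_def pcompose_sum pcompose_smult pow shift Fn)
  ultimately have "p * ?T - 1 = pcompose (q * T - 1) [:- a, 1:]"
    by (simp add: pcompose_diff pcompose_mult pcompose_1)
  also have "\<dots> = [:- a, 1:] ^ N * pcompose u [:- a, 1:]"
    unfolding u by (simp add: pcompose_mult pow shift)
  finally show ?thesis by simp
qed

lemma L_poly_dvd_other:
  assumes "i \<in> {1..s}" "i \<noteq> j"
  shows "[:- \<alpha> i, 1:] ^ m i dvd L_poly s \<alpha> m j r"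
proof -
  have "[:- \<alpha> i, 1:] ^ m i dvd cofactor_poly s \<alpha> m j"
    unfolding cofactor_poly_def using assms by (intro dvd_prodI) auto
  then show ?thesis unfolding L_poly_def by (simp add: dvd_mult2)
qed

text \<open>The Taylor polynomial in \<open>L\<^sub>j\<^sub>r\<close> inverts the cofactor only up to order
  \<open>m\<^sub>j - r\<close>; the factor \<open>(x - \<alpha>\<^sub>j)^r\<close> supplies the missing \<open>r\<close> orders.\<close>

lemma L_poly_local:
  assumes "inj_on \<alpha> {1..s}" "j \<in> {1..s}" "r < m j"
  shows "[:- \<alpha> j, 1:] ^ m j dvd L_poly s \<alpha> m j r - [:- \<alpha> j, 1:] ^ r"
proof -
  let ?x = "[:- \<alpha> j, 1:]" and ?P = "cofactor_poly s \<alpha> m j"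
  let ?S = "\<Sum>i<m j - r. Polynomial.smult
      ((deriv ^^ i) (\<lambda>x. 1 / poly ?P x) (\<alpha> j) / fact i) (?x ^ i)"
  have range: "{0..m j - 1 - r} = {..<m j - r}" using assms(3) by auto
  have "recip_cofactor s \<alpha> m j = (\<lambda>x. 1 / poly ?P x)"
    by (simp add: recip_cofactor_def fun_eq_iff)
  then have L: "L_poly s \<alpha> m j r = ?P * ?x ^ r * ?S"
    by (simp only: L_poly_def range times_divide_eq_left mult_1_left)
  have ac: "u * (v * w) = v * u * w" for u v w :: "complex poly" by simp
  have "poly ?P (\<alpha> j) \<noteq> 0"
    using assms(1,2) by (simp add: cofactor_poly_def poly_prod inj_on_eq_iff)
  then have "?x ^ (m j - r) dvd ?P * ?S - 1" by (rule taylor_inverse_dvd)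
  then have "?x ^ r * ?x ^ (m j - r) dvd ?x ^ r * (?P * ?S - 1)"
    by (rule mult_dvd_mono[OF dvd_refl])
  also have "?x ^ r * (?P * ?S - 1) = L_poly s \<alpha> m j r - ?x ^ r"
    unfolding L by (simp only: right_diff_distrib mult_1_right ac)
  also have "?x ^ r * ?x ^ (m j - r) = ?x ^ m j"
    using assms(3) by (simp flip: power_add)
  finally show ?thesis .
qed

text \<open>The binomial expansion of \<open>x^n = ((x - a) + a)^n\<close>, truncated at order \<open>M\<close>. It also
  holds for \<open>M > n\<close>, since the binomial coefficients with \<open>r > n\<close> are zero.\<close>

lemma monom_local:
  fixes a :: complex
  shows "[:- a, 1:] ^ M dvd Polynomial.monom 1 n
    - (\<Sum>r<M. Polynomial.smult (of_nat (n choose r) * a ^ (n - r)) ([:- a, 1:] ^ r))"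
proof -
  let ?f = "\<lambda>r. Polynomial.smult (of_nat (n choose r) * a ^ (n - r)) ([:- a, 1:] ^ r)"
  have "Polynomial.monom 1 n = ([:- a, 1:] + [:a:]) ^ n" by (simp add: monom_altdef)
  also have "\<dots> = (\<Sum>r\<le>n. ?f r)"
    unfolding binomial_ring
    by (intro sum.cong refl) (simp add: of_nat_poly poly_const_pow mult_ac)
  \<comment> \<open>The extra terms are zero; they make the range of summation contain both
    \<open>{..<M}\<close> and \<open>{..n}\<close>.\<close>
  also have "\<dots> = (\<Sum>r<M + Suc n. ?f r)"
    by (intro sum.mono_neutral_left) auto
  also have "\<dots> = (\<Sum>r<M. ?f r) + (\<Sum>r\<in>{M..<M + Suc n}. ?f r)"
    by (simp only: lessThan_atLeast0) (rule sum.atLeastLessThan_concat[symmetric], auto)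
  finally have "Polynomial.monom 1 n - (\<Sum>r<M. ?f r) = (\<Sum>r\<in>{M..<M + Suc n}. ?f r)" by simp
  also have "[:- a, 1:] ^ M dvd \<dots>"
    by (intro dvd_sum dvd_smult le_imp_power_dvd) auto
  finally show ?thesis .
qed

lemma root_poly_dvd:
  assumes "inj_on \<alpha> {1..s}" and "\<And>i. i \<in> {1..s} \<Longrightarrow> [:- \<alpha> i, 1:] ^ m i dvd p"
  shows "root_poly s \<alpha> m dvd p"
proof -
  have cop: "coprime [:- a, 1:] [:- b, 1:]" if "a \<noteq> b" for a b :: complex
  proof (rule coprimeI)
    fix d assume "d dvd [:- a, 1:]" "d dvd [:- b, 1:]"
    then have "d dvd [:- b, 1:] - [:- a, 1:]" by (rule dvd_diff[rotated])
    then have "d dvd [:a - b:]" by simp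
    moreover have "[:a - b:] dvd 1" using that by (simp add: is_unit_pCons_iff)
    ultimately show "is_unit d" using dvd_trans by blast
  qed
  have "finite I \<Longrightarrow> I \<subseteq> {1..s} \<Longrightarrow> (\<Prod>i\<in>I. [:- \<alpha> i, 1:] ^ m i) dvd p" for I
  proof (induction rule: finite_induct)
    case (insert i I)
    have "coprime ([:- \<alpha> i, 1:] ^ m i) (\<Prod>j\<in>I. [:- \<alpha> j, 1:] ^ m j)"
    proof (rule prod_coprime_right)
      fix j assume "j \<in> I"
      then have "\<alpha> i \<noteq> \<alpha> j" using insert assms(1) by (metis inj_onD insert_subset subsetD)
      then show "coprime ([:- \<alpha> i, 1:] ^ m i) ([:- \<alpha> j, 1:] ^ m j)"
        by (simp add: cop)
    qed
    then show ?case using insert assms(2) by (simp add: divides_mult)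
  qed simp
  then show ?thesis unfolding root_poly_def by simp
qed

text \<open>Hermite interpolation of \<open>x^n\<close>: near \<open>\<alpha>\<^sub>i\<close> only the summand \<open>j = i\<close> survives, and
  there it agrees with the truncated binomial expansion.\<close>

lemma hermite_monom:
  assumes "inj_on \<alpha> {1..s}"
  shows "root_poly s \<alpha> m dvd Polynomial.monom 1 n - (\<Sum>j\<in>{1..s}. \<Sum>r<m j.
      Polynomial.smult (of_nat (n choose r) * \<alpha> j ^ (n - r)) (L_poly s \<alpha> m j r))"
    (is "_ dvd _ - (\<Sum>j\<in>_. ?H j)")
proof (rule root_poly_dvd[OF assms])
  fix i assume i: "i \<in> {1..s}"
  let ?x = "[:- \<alpha> i, 1:]"
  let ?M = "\<Sum>r<m i. Polynomial.smult (of_nat (n choose r) * \<alpha> i ^ (n - r)) (?x ^ r)"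
  have 1: "?x ^ m i dvd Polynomial.monom 1 n - ?M" by (rule monom_local)
  have 2: "?x ^ m i dvd ?H i - ?M"
    unfolding sum_subtractf[symmetric] smult_diff_right[symmetric]
    using L_poly_local[OF assms i] by (intro dvd_sum dvd_smult) auto
  have 3: "?x ^ m i dvd (\<Sum>j\<in>{1..s} - {i}. ?H j)"
    using L_poly_dvd_other[OF i] by (intro dvd_sum dvd_smult) auto
  have regroup: "(u - v) - (h - v) - w = u - (h + w)" for u v h w :: "complex poly" by simp
  have sum_split: "(\<Sum>j\<in>{1..s}. ?H j) = ?H i + (\<Sum>j\<in>{1..s} - {i}. ?H j)"
    using i by (intro sum.remove) auto
  have "?x ^ m i dvd
      (Polynomial.monom 1 n - ?M) - (?H i - ?M) - (\<Sum>j\<in>{1..s} - {i}. ?H j)"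
    by (rule dvd_diff[OF dvd_diff[OF 1 2] 3])
  then show "?x ^ m i dvd Polynomial.monom 1 n - (\<Sum>j\<in>{1..s}. ?H j)"
    unfolding sum_split regroup .
qed

text \<open>Of the two cofactors, the one of \<open>i\<close> contains every root power except that of \<open>\<alpha>\<^sub>i\<close>,
  and this one is contained in the cofactor of \<open>j\<close>.\<close>

lemma root_poly_dvd_L_poly_mult:
  assumes "inj_on \<alpha> {1..s}" "i \<noteq> j"
  shows "root_poly s \<alpha> m dvd L_poly s \<alpha> m i q * L_poly s \<alpha> m j r"
proof (rule root_poly_dvd[OF assms(1)])
  fix l assume l: "l \<in> {1..s}"
  show "[:- \<alpha> l, 1:] ^ m l dvd L_poly s \<alpha> m i q * L_poly s \<alpha> m j r"
  proof (cases "l = i")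
    case True
    then show ?thesis using L_poly_dvd_other[OF l, of j] assms(2) by (intro dvd_mult) auto
  next
    case False
    then show ?thesis by (intro dvd_mult2 L_poly_dvd_other l)
  qed
qed

section \<open>The exponential formula\<close>

text \<open>The terms with \<open>n < r\<close> vanish, and the shift \<open>n \<mapsto> n + r\<close> turns the rest into
  \<open>t^r / r!\<close> times the exponential series of \<open>a t\<close>.\<close>

lemma binomial_exp_sums:
  fixes a t :: complex
  shows "(\<lambda>n. t ^ n / fact n * (of_nat (n choose r) * a ^ (n - r)))
    sums (t ^ r / fact r * exp (a * t))"
proof -
  let ?f = "\<lambda>n. t ^ n / fact n * (of_nat (n choose r) * a ^ (n - r))"
  have "(\<lambda>n. ?f (n + r)) = (\<lambda>n. t ^ r / fact r * ((a * t) ^ n /\<^sub>R fact n))"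
    by (rule ext) (simp add: binomial_fact scaleR_conv_of_real power_add power_mult_distrib field_simps)
  then have "(\<lambda>n. ?f (n + r)) sums (t ^ r / fact r * exp (a * t))"
    using sums_mult[OF exp_converges[of "a * t"], of "t ^ r / fact r"] by (simp only:)
  moreover have "(\<Sum>n<r. ?f n) = 0" by (intro sum.neutral) auto
  ultimately show ?thesis using sums_iff_shift[of ?f r] by simp
qed

theorem theorem2p8:
  fixes A :: "complex mat" and k s :: nat
    and \<alpha> :: "nat \<Rightarrow> complex" and m :: "nat \<Rightarrow> nat"
    and B :: "nat \<Rightarrow> nat \<Rightarrow> complex mat"
  assumes "k \<ge> 1"
    and "A \<in> carrier_mat k k"
    and "inj_on \<alpha> {1..s}"
    and "char_poly A = root_poly s \<alpha> m"
    and "\<And>j r. j \<in> {1..s} \<Longrightarrow> r < m j \<Longrightarrow> B j r = poly_at_mat (L_poly s \<alpha> m j r) A"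
  shows "(\<forall>t. exp_mat t A =
            (\<Oplus>\<^bsub>module_mat TYPE(complex) k k\<^esub> j\<in>{1..s}.
              \<Oplus>\<^bsub>module_mat TYPE(complex) k k\<^esub> r\<in>{..<m j}.
                (t ^ r / fact r * exp (\<alpha> j * t)) \<cdot>\<^sub>m B j r))
       \<and> (\<forall>i\<in>{1..s}. \<forall>j\<in>{1..s}. i \<noteq> j \<longrightarrow>
            (\<forall>q<m i. \<forall>r<m j. B i q * B j r = 0\<^sub>m k k \<and> B j r * B i q = 0\<^sub>m k k))"
proof (intro conjI allI ballI impI)
  note A = assms(2) and B = assms(5)
  have Bc: "B j r \<in> carrier_mat k k" if "j \<in> {1..s}" "r < m j" for j r
    using B[OF that] poly_at_mat_closed[OF A] by simp
  \<comment> \<open>The Hermite interpolation of \<open>x^n\<close> is exact at \<open>A\<close>, as its error is a multiple of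
    the characteristic polynomial.\<close>
  have power: "(A ^\<^sub>m n) $$ (a, b) = (\<Sum>j\<in>{1..s}. \<Sum>r<m j.
      (of_nat (n choose r) * \<alpha> j ^ (n - r)) * B j r $$ (a, b))" if ab: "a < k" "b < k" for n a b
  proof -
    let ?H = "\<Sum>j\<in>{1..s}. \<Sum>r<m j.
      Polynomial.smult (of_nat (n choose r) * \<alpha> j ^ (n - r)) (L_poly s \<alpha> m j r)"
    have "poly_at_mat (Polynomial.monom 1 n - ?H) A = 0\<^sub>m k k"
      using hermite_monom[OF assms(3)] assms(4) by (intro poly_at_mat_eq_0[OF A]) simp
    then have "poly_at_mat ((Polynomial.monom 1 n - ?H) + ?H) A = poly_at_mat ?H A"
      unfolding poly_at_mat_add[OF A] using left_add_zero_mat[OF poly_at_mat_closed[OF A]] by simp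
    then have "(A ^\<^sub>m n) $$ (a, b) = poly_at_mat ?H A $$ (a, b)"
      by (simp add: poly_at_mat_monom[OF A])
    also have "\<dots> = (\<Sum>j\<in>{1..s}. \<Sum>r<m j.
        (of_nat (n choose r) * \<alpha> j ^ (n - r)) * B j r $$ (a, b))"
      unfolding index_poly_at_mat_sum[OF A ab] poly_at_mat_smult[OF A]
      using ab carrier_matD[OF poly_at_mat_closed[OF A]] by (intro sum.cong refl) (simp add: B)
    finally show ?thesis .
  qed
  fix t
  let ?G = "\<lambda>j. \<Oplus>\<^bsub>module_mat TYPE(complex) k k\<^esub> r\<in>{..<m j}.
    (t ^ r / fact r * exp (\<alpha> j * t)) \<cdot>\<^sub>m B j r"
  have Gc: "?G j \<in> carrier_mat k k" if "j \<in> {1..s}" for j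
    using Bc[OF that] by (intro finsum_mat_closed) auto
  show "exp_mat t A = finsum (module_mat TYPE(complex) k k) ?G {1..s}"
  proof (rule eq_matI)
    have Rc: "finsum (module_mat TYPE(complex) k k) ?G {1..s} \<in> carrier_mat k k"
      by (rule finsum_mat_closed[OF finite_atLeastAtMost Gc])
    show "dim_row (exp_mat t A) = dim_row (finsum (module_mat TYPE(complex) k k) ?G {1..s})"
      "dim_col (exp_mat t A) = dim_col (finsum (module_mat TYPE(complex) k k) ?G {1..s})"
      using A carrier_matD[OF Rc] by (auto simp: exp_mat_def)
    fix a b
    assume "a < dim_row (finsum (module_mat TYPE(complex) k k) ?G {1..s})"
      "b < dim_col (finsum (module_mat TYPE(complex) k k) ?G {1..s})"
    then have ab: "a < k" "b < k" using carrier_matD[OF Rc] by auto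
    have "(t ^ n / fact n \<cdot>\<^sub>m (A ^\<^sub>m n)) $$ (a, b) = (\<Sum>j\<in>{1..s}. \<Sum>r<m j.
        t ^ n / fact n * (of_nat (n choose r) * \<alpha> j ^ (n - r)) * B j r $$ (a, b))" for n
      using ab carrier_matD[OF pow_carrier_mat[OF A]] power[OF ab]
      by (simp add: sum_distrib_left mult.assoc)
    then have "(\<lambda>n. (t ^ n / fact n \<cdot>\<^sub>m (A ^\<^sub>m n)) $$ (a, b)) sums
        (\<Sum>j\<in>{1..s}. \<Sum>r<m j. t ^ r / fact r * exp (\<alpha> j * t) * B j r $$ (a, b))"
      by (simp only:) (intro sums_sum sums_mult2[OF binomial_exp_sums])
    then have "exp_mat t A $$ (a, b)
        = (\<Sum>j\<in>{1..s}. \<Sum>r<m j. t ^ r / fact r * exp (\<alpha> j * t) * B j r $$ (a, b))"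
      using exp_mat_sums[OF A ab] sums_unique2 by blast
    also have "\<dots> = (\<Sum>j\<in>{1..s}. ?G j $$ (a, b))"
    proof (rule sum.cong[OF refl])
      fix j assume j: "j \<in> {1..s}"
      have "?G j $$ (a, b) = (\<Sum>r<m j. ((t ^ r / fact r * exp (\<alpha> j * t)) \<cdot>\<^sub>m B j r) $$ (a, b))"
        using Bc[OF j] ab by (intro index_finsum_mat) auto
      then show "(\<Sum>r<m j. t ^ r / fact r * exp (\<alpha> j * t) * B j r $$ (a, b)) = ?G j $$ (a, b)"
        using ab carrier_matD[OF Bc[OF j]] by simp
    qed
    also have "\<dots> = finsum (module_mat TYPE(complex) k k) ?G {1..s} $$ (a, b)"
      by (rule index_finsum_mat[symmetric, OF finite_atLeastAtMost Gc ab])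
    finally show "exp_mat t A $$ (a, b)
        = finsum (module_mat TYPE(complex) k k) ?G {1..s} $$ (a, b)" .
  qed
next
  note A = assms(2) and B = assms(5)
  fix i j q r assume ij: "i \<in> {1..s}" "j \<in> {1..s}" "i \<noteq> j" "q < m i" "r < m j"
  have "poly_at_mat (L_poly s \<alpha> m i q * L_poly s \<alpha> m j r) A = 0\<^sub>m k k"
    "poly_at_mat (L_poly s \<alpha> m j r * L_poly s \<alpha> m i q) A = 0\<^sub>m k k"
    using root_poly_dvd_L_poly_mult[OF assms(3)] assms(4) ij(3)
    by (auto intro!: poly_at_mat_eq_0[OF A])
  then show "B i q * B j r = 0\<^sub>m k k" "B j r * B i q = 0\<^sub>m k k"
    using ij by (simp_all add: B poly_at_mat_mult[OF A])
qed

end
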